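(* Let $n\in\mathbb{N}^*$ and $x\in\mathbb{R}^n$. Then: (i) $\mathbb{R}[x]=\mathcal{D}\text{-}\mathcal{SOS}_{n}=\mathcal{DC}\text{-}\mathcal{SOS}_{n}$. (ii) For any D-SOS (resp. DC-SOS) components $s_1$ and $s_2$ of a polynomial $p\in\mathbb{R}[x]$, we have $\max\{\deg(s_1),\deg(s_2)\}\geq 2\left\lceil\frac{\deg(p)}{2}\right\rceil$. (iii) For any $p\in\mathbb{R}[x]$, there exist D-SOS (resp. DC-SOS) components $s_1$ and $s_2$ of $p$ such that $\max\{\deg(s_1),\deg(s_2)\}=2\left\lceil\frac{\deg(p)}{2}\right\rceil$.
   Context: $\mathbb{N}^*=\mathbb{N}\setminus\{0\}$. $\mathbb{R}[x]$ is the space of real polynomials in $x\in\mathbb{R}^n$. A polynomial is SOS if it is a finite sum of squares of polynomials, and CSOS if it is both convex on $\mathbb{R}^n$ and SOS. A polynomial $p$ is D-SOS (resp. DC-SOS) if $p=s_1-s_2$ with $s_1,s_2$ SOS (resp. CSOS) polynomials; then $s_1,s_2$ are called D-SOS (resp. DC-SOS) components of $p$. $\mathcal{D}\text{-}\mathcal{SOS}_n$ (resp. $\mathcal{DC}\text{-}\mathcal{SOS}_n$) is the set of D-SOS (resp. DC-SOS) polynomials in $\mathbb{R}[x]$. The zero polynomial is given degree $0$. *)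

theory Defs
  imports "HOL-Analysis.Analysis" "HOL-Library.Poly_Mapping"
begin

text \<open>Real polynomials in the indeterminates indexed by the finite type \<open>'n\<close>, as the monoid algebra of
  the exponent vectors: a polynomial maps each exponent vector to its coefficient, and the
  multiplication on \<open>\<Rightarrow>\<^sub>0\<close> is convolution. The number of variables is \<open>n = CARD('n)\<close>, which is
  automatically at least one.\<close>

type_synonym 'n mono = "'n \<Rightarrow>\<^sub>0 nat"
type_synonym 'n rpoly = "'n mono \<Rightarrow>\<^sub>0 real"

definition mono_degree :: "'n::finite mono \<Rightarrow> nat" where
  "mono_degree m = (\<Sum>i\<in>UNIV. Poly_Mapping.lookup m i)"

text \<open>The inserted \<open>0\<close> only matters for the zero polynomial, which thereby gets degree \<open>0\<close>.\<close>

definition total_degree :: "'n::finite rpoly \<Rightarrow> nat" where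
  "total_degree p = Max (insert 0 (mono_degree ` Poly_Mapping.keys p))"

definition poly_eval :: "'n::finite rpoly \<Rightarrow> real ^ 'n \<Rightarrow> real" where
  "poly_eval p x = (\<Sum>m\<in>Poly_Mapping.keys p. Poly_Mapping.lookup p m * (\<Prod>i\<in>UNIV. (x $ i) ^ Poly_Mapping.lookup m i))"

definition SOS :: "'n::finite rpoly \<Rightarrow> bool" where
  "SOS p \<longleftrightarrow> (\<exists>qs :: 'n rpoly list. p = (\<Sum>q\<leftarrow>qs. q ^ 2))"

definition CSOS :: "'n::finite rpoly \<Rightarrow> bool" where
  "CSOS p \<longleftrightarrow> convex_on UNIV (poly_eval p) \<and> SOS p"

definition DSOS_components :: "'n::finite rpoly \<Rightarrow> 'n rpoly \<Rightarrow> 'n rpoly \<Rightarrow> bool" where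
  "DSOS_components p s1 s2 \<longleftrightarrow> SOS s1 \<and> SOS s2 \<and> p = s1 - s2"

definition DCSOS_components :: "'n::finite rpoly \<Rightarrow> 'n rpoly \<Rightarrow> 'n rpoly \<Rightarrow> bool" where
  "DCSOS_components p s1 s2 \<longleftrightarrow> CSOS s1 \<and> CSOS s2 \<and> p = s1 - s2"

definition DSOS :: "'n::finite rpoly set" where
  "DSOS = {p. \<exists>s1 s2. DSOS_components p s1 s2}"

definition DCSOS :: "'n::finite rpoly set" where
  "DCSOS = {p. \<exists>s1 s2. DCSOS_components p s1 s2}"

end

theory Submission
  imports Defs
begin

text \<open>Existence: the \<open>k\<close>-th powers of affine forms span the polynomials of degree at most \<open>k\<close>; for even
  \<open>k\<close> such powers are convex squares, so collecting the positive and the negative coefficients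
  of such a combination gives DC-SOS components.
  Lower bound: an SOS polynomial has even degree. Among the top-degree exponents of the squared
  polynomials choose \<open>m\<close> with the largest Euclidean norm. By the parallelogram identity \<open>2m\<close>
  is a sum of two such exponents only as \<open>m + m\<close>, so its coefficient is a nonzero sum of squares.\<close>

section \<open>Exponents, degree and evaluation\<close>

lemma mono_degree_0 [simp]: "mono_degree 0 = 0"
  by (simp add: mono_degree_def)

lemma mono_degree_add: "mono_degree (a + b) = mono_degree a + mono_degree b"
  by (simp add: mono_degree_def lookup_add sum.distrib)

lemma mono_degree_single [simp]: "mono_degree (Poly_Mapping.single i k) = k"
  by (simp add: mono_degree_def lookup_single when_def)

lemma mono_degree_eq_0_iff [simp]: "mono_degree m = 0 \<longleftrightarrow> m = 0"
  by (auto simp: mono_degree_def intro!: poly_mapping_eqI)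

text \<open>Splits one variable off a nonconstant monomial: the step for induction on the
  degree.\<close>

lemma mono_degree_SucE:
  assumes "mono_degree m = Suc k"
  obtains i m' where "m = Poly_Mapping.single i 1 + m'" "mono_degree m' = k"
proof -
  obtain i where i: "Poly_Mapping.lookup m i \<noteq> 0"
    using assms by (metis Zero_not_Suc mono_degree_0 lookup_zero poly_mapping_eqI)
  have "m = Poly_Mapping.single i 1 + (m - Poly_Mapping.single i 1)"
    using i by (intro poly_mapping_eqI) (auto simp: lookup_add lookup_minus lookup_single when_def)
  with that assms show thesis
    by (metis One_nat_def add_diff_cancel_left' diff_Suc_1 mono_degree_add mono_degree_single)
qed

lemma total_degree_le_iff: "total_degree p \<le> d \<longleftrightarrow> (\<forall>m\<in>Poly_Mapping.keys p. mono_degree m \<le> d)"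
  by (simp add: total_degree_def)

lemma total_degree_le: "m \<in> Poly_Mapping.keys p \<Longrightarrow> mono_degree m \<le> total_degree p"
  using total_degree_le_iff by blast

lemma total_degree_0 [simp]: "total_degree 0 = 0"
  by (simp add: total_degree_def)

lemma total_degree_single: "total_degree (Poly_Mapping.single m c) \<le> mono_degree m"
  by (simp add: total_degree_le_iff)

lemma total_degree_const [simp]: "total_degree (Poly_Mapping.single 0 c) = 0"
  using total_degree_single[of 0 c] by simp

lemma total_degree_1 [simp]: "total_degree 1 = 0"
  using total_degree_const[of 1] by simp

lemma total_degree_add_le:
  assumes "total_degree p \<le> d" "total_degree q \<le> d"
  shows "total_degree (p + q) \<le> d"
  using assms keys_add[of p q] by (auto simp: total_degree_le_iff)

lemma total_degree_diff_le:
  assumes "total_degree p \<le> d" "total_degree q \<le> d"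
  shows "total_degree (p - q) \<le> d"
  using assms by (auto simp: total_degree_le_iff in_keys_iff lookup_minus)

lemma total_degree_mult_le:
  assumes "total_degree p \<le> d" "total_degree q \<le> e"
  shows "total_degree (p * q) \<le> d + e"
  using assms keys_mult[of p q]
  by (fastforce simp: total_degree_le_iff mono_degree_add intro: add_mono)

lemma total_degree_power_le:
  assumes "total_degree p \<le> d"
  shows "total_degree (p ^ k) \<le> k * d"
proof (induction k)
  case 0
  show ?case by simp
next
  case (Suc k)
  then show ?case using total_degree_mult_le[OF assms Suc] by simp
qed

section \<open>Evaluation as a ring homomorphism\<close>

lemma poly_mapping_eq_sum_single:
  "p = (\<Sum>m\<in>Poly_Mapping.keys p. Poly_Mapping.single m (Poly_Mapping.lookup p m))"
  by (rule poly_mapping_eqI) (simp add: lookup_sum lookup_single when_def in_keys_iff)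

lemma poly_eval_superset:
  assumes "finite A" "Poly_Mapping.keys p \<subseteq> A"
  shows "poly_eval p x = (\<Sum>m\<in>A. Poly_Mapping.lookup p m * (\<Prod>i\<in>UNIV. (x $ i) ^ Poly_Mapping.lookup m i))"
  unfolding poly_eval_def using assms by (intro sum.mono_neutral_left) (auto simp: in_keys_iff)

lemma poly_eval_0 [simp]: "poly_eval 0 x = 0"
  by (simp add: poly_eval_def)

lemma poly_eval_single:
  "poly_eval (Poly_Mapping.single m c) x = c * (\<Prod>i\<in>UNIV. (x $ i) ^ Poly_Mapping.lookup m i)"
  by (simp add: poly_eval_def)

lemma poly_eval_const [simp]: "poly_eval (Poly_Mapping.single 0 c) x = c"
  by (simp add: poly_eval_single)

lemma poly_eval_1 [simp]: "poly_eval 1 x = 1"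
  using poly_eval_const[of 1 x] by simp

lemma poly_eval_add: "poly_eval (p + q) x = poly_eval p x + poly_eval q x"
proof -
  let ?A = "Poly_Mapping.keys p \<union> Poly_Mapping.keys q"
  have "Poly_Mapping.keys (p + q) \<subseteq> ?A" by (rule keys_add)
  then show ?thesis
    by (simp add: poly_eval_superset[of ?A] lookup_add sum.distrib ring_distribs)
qed

lemma poly_eval_sum: "poly_eval (sum f A) x = (\<Sum>a\<in>A. poly_eval (f a) x)"
  by (induction A rule: infinite_finite_induct) (auto simp: poly_eval_add)

lemma poly_eval_mult: "poly_eval (p * q) x = poly_eval p x * poly_eval q x"
proof -
  \<comment> \<open>Expanding both factors into terms reduces multiplicativity to monomials, whose
    exponents add.\<close>
  have "p * q = (\<Sum>a\<in>Poly_Mapping.keys p. \<Sum>b\<in>Poly_Mapping.keys q.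
      Poly_Mapping.single (a + b) (Poly_Mapping.lookup p a * Poly_Mapping.lookup q b))"
    by (subst (1) poly_mapping_eq_sum_single[of p], subst (1) poly_mapping_eq_sum_single[of q])
       (simp add: sum_product mult_single)
  then show ?thesis
    by (simp add: poly_eval_sum poly_eval_single poly_eval_def[of p] poly_eval_def[of q] sum_product
        lookup_add power_add prod.distrib mult_ac)
qed

lemma poly_eval_power: "poly_eval (p ^ k) x = poly_eval p x ^ k"
  by (induction k) (auto simp: poly_eval_mult)

section \<open>Degrees of sums of squares\<close>

text \<open>The only pair of exponents of \<open>q\<close> that can reach \<open>m + m\<close> is
  \<open>(m, m)\<close>, so nothing cancels the square. If \<open>m\<close> does not occur in
  \<open>q\<close>, both sides are 0; this case matters because one \<open>m\<close> will serve a
  whole list of polynomials.\<close>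

lemma lookup_square_extremal:
  fixes q :: "'n::finite rpoly"
  assumes "\<And>a b. a \<in> Poly_Mapping.keys q \<Longrightarrow> b \<in> Poly_Mapping.keys q \<Longrightarrow> a + b = m + m \<Longrightarrow> a = m \<and> b = m"
  shows "Poly_Mapping.lookup (q ^ 2) (m + m) = (Poly_Mapping.lookup q m) ^ 2"
proof (cases "m \<in> Poly_Mapping.keys q")
  case False
  then have "m + m \<notin> Poly_Mapping.keys (q * q)"
    using keys_mult[of q q] assms by fastforce
  with False show ?thesis by (simp add: in_keys_iff power2_eq_square)
next
  case True
  define c where "c = Poly_Mapping.lookup q m"
  define r where "r = q - Poly_Mapping.single m c"
  have q: "q = Poly_Mapping.single m c + r" by (simp add: r_def)
  have r: "a \<in> Poly_Mapping.keys q \<and> a \<noteq> m" if "a \<in> Poly_Mapping.keys r" for a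
    using that by (auto simp: r_def c_def in_keys_iff lookup_minus lookup_single when_def split: if_splits)
  \<comment> \<open>All exponents of \<open>r\<close> differ from \<open>m\<close>, so by
    extremality neither the mixed products nor \<open>r * r\<close> reach
    \<open>m + m\<close>.\<close>
  have 1: "m + m \<notin> Poly_Mapping.keys (Poly_Mapping.single m c * r)"
    using keys_mult[of "Poly_Mapping.single m c" r] r assms True by (fastforce split: if_splits)
  have 2: "m + m \<notin> Poly_Mapping.keys (r * r)"
    using keys_mult[of r r] r assms by fastforce
  have sq: "q ^ 2 = Poly_Mapping.single (m + m) (c * c) + (Poly_Mapping.single m c * r + Poly_Mapping.single m c * r) + r * r"
    by (subst q) (simp add: power2_eq_square ring_distribs mult_single mult.commute)
  show ?thesis
    unfolding sq lookup_add using 1 2 by (simp add: in_keys_iff c_def power2_eq_square)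
qed

lemma lookup_sum_list: "Poly_Mapping.lookup (sum_list ps) m = (\<Sum>p\<leftarrow>ps. Poly_Mapping.lookup p m)"
  by (induction ps) (auto simp: lookup_add)

lemma total_degree_sum_list_le:
  assumes "\<And>p. p \<in> set ps \<Longrightarrow> total_degree p \<le> d"
  shows "total_degree (sum_list ps) \<le> d"
  using assms by (induction ps) (auto intro: total_degree_add_le)

text \<open>The degree is exactly \<open>2 * D\<close>, with \<open>D\<close> the largest degree
  among the squared polynomials: leading terms of squares cannot all cancel.\<close>

lemma even_total_degree_SOS:
  fixes s :: "'n::finite rpoly"
  assumes "SOS s"
  shows "even (total_degree s)"
proof -
  obtain qs :: "'n rpoly list" where s: "s = (\<Sum>q\<leftarrow>qs. q ^ 2)"
    using assms by (auto simp: SOS_def)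
  define K where "K = (\<Union>q\<in>set qs. Poly_Mapping.keys q)"
  \<comment> \<open>The inserted 0 gives \<open>D\<close> a value when no exponent occurs at
    all.\<close>
  define D where "D = Max (insert 0 (mono_degree ` K))"
  have K: "finite K" by (simp add: K_def)
  have D: "mono_degree m \<le> D" if "m \<in> K" for m
    using that K by (simp add: D_def)
  have deg_q: "total_degree q \<le> D" if "q \<in> set qs" for q
    using that D by (auto simp: total_degree_le_iff K_def)
  have upper: "total_degree s \<le> 2 * D"
    unfolding s using total_degree_power_le[OF deg_q, of _ 2]
    by (intro total_degree_sum_list_le) auto
  show ?thesis
  proof (cases "D = 0")
    case True
    with upper show ?thesis by simp
  next
    case False
    define E where "E = {m\<in>K. mono_degree m = D}"
    \<comment> \<open>As \<open>D\<close> is nonzero here, it is attained by an actual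
      exponent.\<close>
    have "D \<in> insert 0 (mono_degree ` K)"
      unfolding D_def using K by (intro Max_in) auto
    with False have E: "finite E" "E \<noteq> {}" using K by (auto simp: E_def)
    define nrm where "nrm = (\<lambda>m::'n mono. \<Sum>i\<in>UNIV. (real (Poly_Mapping.lookup m i)) ^ 2)"
    obtain m where mE: "m \<in> E" and m: "nrm m = Max (nrm ` E)"
      using Max_in[of "nrm ` E"] E by (metis (no_types, lifting) finite_imageI image_iff image_is_empty)
    have m_max: "nrm a \<le> nrm m" if "a \<in> E" for a
      using that E by (simp add: m)
    have extremal: "a = m \<and> b = m" if ab: "a \<in> K" "b \<in> K" "a + b = m + m" for a b
    proof -
      have "mono_degree a + mono_degree b = D + D"
        using ab mE by (metis (mono_tags, lifting) E_def mem_Collect_eq mono_degree_add)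
      \<comment> \<open>Two degrees of at most \<open>D\<close> with sum \<open>2 * D\<close> both
        equal \<open>D\<close>.\<close>
      with D[OF ab(1)] D[OF ab(2)] ab have "a \<in> E" "b \<in> E" by (auto simp: E_def)
      then have le: "nrm a + nrm b \<le> 2 * nrm m" using m_max by (smt (verit))
      have lk: "real (Poly_Mapping.lookup a i) + real (Poly_Mapping.lookup b i) = 2 * real (Poly_Mapping.lookup m i)" for i
        using arg_cong[OF ab(3), of "\<lambda>f. real (Poly_Mapping.lookup f i)"] by (simp add: lookup_add)
      \<comment> \<open>The parallelogram identity in each coordinate, with
        \<open>a + b = 2 m\<close>. Summed over \<open>i\<close>, maximality of \<open>nrm m\<close>
        makes the right side at most 0, which forces \<open>a = b\<close>.\<close>
      have "(real (Poly_Mapping.lookup a i) - real (Poly_Mapping.lookup b i)) ^ 2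
          = 2 * (real (Poly_Mapping.lookup a i)) ^ 2 + 2 * (real (Poly_Mapping.lookup b i)) ^ 2
            - 4 * (real (Poly_Mapping.lookup m i)) ^ 2" for i
      proof -
        have "4 * (real (Poly_Mapping.lookup m i)) ^ 2 = (real (Poly_Mapping.lookup a i) + real (Poly_Mapping.lookup b i)) ^ 2"
          by (simp add: lk power2_eq_square)
        then show ?thesis by (simp add: power2_eq_square algebra_simps)
      qed
      then have "(\<Sum>i\<in>UNIV. (real (Poly_Mapping.lookup a i) - real (Poly_Mapping.lookup b i)) ^ 2)
          = 2 * nrm a + 2 * nrm b - 4 * nrm m"
        by (simp add: nrm_def sum.distrib sum_subtractf sum_distrib_left)
      with le have "(\<Sum>i\<in>UNIV. (real (Poly_Mapping.lookup a i) - real (Poly_Mapping.lookup b i)) ^ 2) \<le> 0"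
        by simp
      then have "(\<Sum>i\<in>UNIV. (real (Poly_Mapping.lookup a i) - real (Poly_Mapping.lookup b i)) ^ 2) = 0"
        by (intro antisym sum_nonneg) auto
      then have eq: "Poly_Mapping.lookup a i = Poly_Mapping.lookup b i" for i
        by (simp add: sum_nonneg_eq_0_iff)
      with lk have "Poly_Mapping.lookup a i = Poly_Mapping.lookup m i" for i
        by (metis mult_2 mult_cancel_left of_nat_eq_iff zero_neq_numeral)
      with eq show ?thesis by (auto intro: poly_mapping_eqI)
    qed
    have "Poly_Mapping.lookup (q ^ 2) (m + m) = (Poly_Mapping.lookup q m) ^ 2" if "q \<in> set qs" for q
      using that by (intro lookup_square_extremal extremal) (auto simp: K_def)
    then have coeff: "Poly_Mapping.lookup s (m + m) = (\<Sum>q\<leftarrow>qs. (Poly_Mapping.lookup q m) ^ 2)"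
      by (simp add: s lookup_sum_list o_def cong: map_cong)
    obtain q where q: "q \<in> set qs" "m \<in> Poly_Mapping.keys q"
      using mE by (auto simp: E_def K_def)
    have "0 < (Poly_Mapping.lookup q m) ^ 2" using q by (simp add: in_keys_iff)
    also have "\<dots> \<le> (\<Sum>q\<leftarrow>qs. (Poly_Mapping.lookup q m) ^ 2)"
      using q(1) by (intro member_le_sum_list) auto
    finally have "m + m \<in> Poly_Mapping.keys s" by (simp add: in_keys_iff coeff)
    then have "2 * D \<le> total_degree s"
      using total_degree_le mE by (fastforce simp: E_def mono_degree_add)
    with upper show ?thesis by simp
  qed
qed

section \<open>Lower bound on the degrees of components\<close>

text \<open>Restates the bound as the least even number that is at least \<open>d\<close>, ready for
  parity arguments.\<close>

lemma two_ceiling_half: "2 * \<lceil>real d / 2\<rceil> = int (2 * ((d + 1) div 2))"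
proof -
  have "\<lceil>real d / 2\<rceil> = int ((d + 1) div 2)"
    by (cases "even d") (auto elim!: evenE oddE simp: ceiling_eq_iff)
  then show ?thesis by simp
qed

text \<open>The maximum is even because both degrees are, and a difference cannot exceed it in
  degree.\<close>

lemma DSOS_components_degree_ge:
  assumes "DSOS_components p s1 s2"
  shows "int (max (total_degree s1) (total_degree s2)) \<ge> 2 * \<lceil>real (total_degree p) / 2\<rceil>"
proof -
  let ?M = "max (total_degree s1) (total_degree s2)"
  have "even ?M"
    using assms by (auto simp: DSOS_components_def max_def even_total_degree_SOS)
  moreover have "total_degree p \<le> ?M"
    using assms by (auto simp: DSOS_components_def intro: total_degree_diff_le)
  ultimately have "2 * ((total_degree p + 1) div 2) \<le> ?M" by presburger
  then show ?thesis unfolding two_ceiling_half by linarith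
qed

section \<open>Powers of affine forms\<close>

text \<open>Scalars act as constant polynomials, so scaling is ring multiplication and commutes with
  multiplying by a fixed polynomial.\<close>

interpretation rpoly: vector_space "\<lambda>(c::real) (p :: 'n rpoly). Poly_Mapping.single 0 c * p"
  by unfold_locales (auto simp: ring_distribs single_add mult_single simp flip: mult.assoc)

text \<open>Induction on \<open>N\<close>: with \<open>f(t) = \<Sum>\<^sub>i t\<^sup>i a\<^sub>i\<close>, passing to \<open>f(2t) - 2\<^sup>N f(t)\<close> removes
  the top coefficient and multiplies each of the others by a nonzero scalar.\<close>

lemma subspace_polynomial_coeffs:
  fixes scale :: "real \<Rightarrow> 'b::ab_group_add \<Rightarrow> 'b"
  assumes "vector_space scale" "module.subspace scale W"
    and "\<And>t. (\<Sum>i\<le>N. scale (t ^ i) (a i)) \<in> W" "i \<le> N"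
  shows "a i \<in> W"
proof -
  interpret vector_space scale by fact
  note W = \<open>subspace W\<close>
  show ?thesis
    using assms(3,4)
  proof (induction N arbitrary: a i)
    case 0
    from "0.prems"(1)[of 1] "0.prems"(2) show ?case by simp
  next
    case (Suc N)
    define f where "f = (\<lambda>t. \<Sum>i\<le>Suc N. scale (t ^ i) (a i))"
    have lower: "a j \<in> W" if "j \<le> N" for j
    proof -
      have "(\<Sum>i\<le>N. scale (t ^ i) (scale (2 ^ i - 2 ^ Suc N) (a i))) \<in> W" for t
      proof -
        have "f (2 * t) - scale (2 ^ Suc N) (f t) \<in> W"
          unfolding f_def using Suc.prems(1) by (intro subspace_diff subspace_scale W)
        also have "f (2 * t) - scale (2 ^ Suc N) (f t)
            = (\<Sum>i\<le>Suc N. scale (t ^ i) (scale (2 ^ i - 2 ^ Suc N) (a i)))"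
          unfolding f_def scale_sum_right sum_subtractf[symmetric]
          by (rule sum.cong) (simp_all add: power_mult_distrib right_diff_distrib scale_left_diff_distrib
              scale_right_diff_distrib mult.commute)
        finally show ?thesis by simp
      qed
      then have "scale (2 ^ j - 2 ^ Suc N) (a j) \<in> W"
        using that by (rule Suc.IH)
      then have "scale (inverse (2 ^ j - 2 ^ Suc N)) (scale (2 ^ j - 2 ^ Suc N) (a j)) \<in> W"
        by (rule subspace_scale[OF W])
      moreover have "(2::real) ^ j \<noteq> 2 ^ Suc N"
        using that by (subst power_inject_exp) auto
      ultimately show ?thesis by simp
    qed
    \<comment> \<open>The top coefficient is the value at \<open>t = 1\<close> minus the lower
      coefficients, already known to lie in \<open>W\<close>.\<close>
    have "(\<Sum>i\<le>Suc N. a i) \<in> W"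
      using Suc.prems(1)[of 1] by simp
    moreover have "(\<Sum>i\<le>N. a i) \<in> W"
      using lower by (intro subspace_sum W) auto
    ultimately have "(\<Sum>i\<le>Suc N. a i) - (\<Sum>i\<le>N. a i) \<in> W"
      by (rule subspace_diff[OF W])
    then have "a (Suc N) \<in> W" by simp
    with lower Suc.prems(2) show ?case by (cases "i = Suc N") auto
  qed
qed

text \<open>Constant terms are allowed in \<open>l\<close>, so that the span reaches all degrees up
  to \<open>k\<close> and not just the homogeneous part.\<close>

definition affine_powers :: "nat \<Rightarrow> 'n::finite rpoly set" where
  "affine_powers k = {l ^ k | l. total_degree l \<le> 1}"

text \<open>Up to the factor \<open>k + 1\<close>, \<open>u v\<^sup>k\<close> is the coefficient of \<open>t\<close> in \<open>(t u + v)\<^sup>k\<^sup>+\<^sup>1\<close>.\<close>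

lemma affine_mult_span:
  fixes u p :: "'n::finite rpoly"
  assumes u: "total_degree u \<le> 1" and p: "p \<in> rpoly.span (affine_powers k)"
  shows "u * p \<in> rpoly.span (affine_powers (Suc k))"
proof -
  let ?W = "rpoly.span (affine_powers (Suc k)) :: 'n rpoly set"
  have power: "u * v ^ k \<in> ?W" if v: "total_degree v \<le> 1" for v
  proof -
    define a where "a = (\<lambda>i. of_nat (Suc k choose i) * u ^ i * v ^ (Suc k - i))"
    have "(\<Sum>i\<le>Suc k. Poly_Mapping.single 0 (t ^ i) * a i) \<in> ?W" for t
    proof -
      \<comment> \<open>Constants multiply like reals, so the powers of \<open>t\<close> can be
        absorbed into \<open>u ^ i\<close> and the binomial theorem applies.\<close>
      have t: "Poly_Mapping.single 0 (t ^ i) = (Poly_Mapping.single 0 t :: 'n rpoly) ^ i" for i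
        by (induction i) (auto simp: mult_single[of 0 _ 0, simplified, symmetric])
      have "(\<Sum>i\<le>Suc k. Poly_Mapping.single 0 (t ^ i) * a i) = (Poly_Mapping.single 0 t * u + v) ^ Suc k"
        unfolding binomial_ring a_def t by (simp add: power_mult_distrib mult_ac)
      moreover have "total_degree (Poly_Mapping.single 0 t * u) \<le> 0 + 1"
        using u by (intro total_degree_mult_le) simp_all
      then have "total_degree (Poly_Mapping.single 0 t * u + v) \<le> 1"
        using v by (simp add: total_degree_add_le)
      ultimately show ?thesis
        by (auto simp: affine_powers_def intro!: rpoly.span_base)
    qed
    then have "a 1 \<in> ?W"
      by (rule subspace_polynomial_coeffs[OF rpoly.vector_space_axioms rpoly.subspace_span]) simp
    then have "Poly_Mapping.single 0 (1 / real (Suc k)) * a 1 \<in> ?W"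
      by (rule rpoly.span_scale)
    moreover have "Poly_Mapping.single 0 (1 / real (Suc k)) * a 1 = u * v ^ k"
    proof -
      have "a 1 = Poly_Mapping.single 0 (real (Suc k)) * (u * v ^ k)"
        by (simp only: a_def single_of_nat) simp
      then show ?thesis by (simp add: mult_single flip: mult.assoc)
    qed
    ultimately show ?thesis by simp
  qed
  \<comment> \<open>Multiplication by \<open>u\<close> is linear, so the case of a single power
    extends to the span.\<close>
  show ?thesis
    using p
  proof (induction rule: rpoly.span_induct_alt)
    case base
    show ?case by (simp add: rpoly.span_zero)
  next
    case (step c x y)
    have "u * x \<in> ?W" using step(1) power by (auto simp: affine_powers_def)
    then have "Poly_Mapping.single 0 c * (u * x) + u * y \<in> ?W"
      using step by (intro rpoly.span_add rpoly.span_scale)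
    then show ?case by (simp add: algebra_simps)
  qed
qed

text \<open>Each step multiplies by an affine form: by a variable if the degree is exactly
  \<open>Suc k\<close>, by the constant 1 if it is smaller.\<close>

lemma monomial_in_span:
  "mono_degree m \<le> k \<Longrightarrow> Poly_Mapping.single m 1 \<in> rpoly.span (affine_powers k)"
proof (induction k arbitrary: m)
  case 0
  \<comment> \<open>The only monomial left is 1, obtained as \<open>0 ^ 0\<close>.\<close>
  then show ?case
    by (auto simp: affine_powers_def total_degree_le_iff intro!: rpoly.span_base exI[of _ 0])
next
  case (Suc k)
  show ?case
  proof (cases "mono_degree m \<le> k")
    case True
    have "1 * Poly_Mapping.single m 1 \<in> rpoly.span (affine_powers (Suc k))"
      by (intro affine_mult_span Suc.IH True) (simp add: total_degree_le_iff)
    then show ?thesis by simp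
  next
    case False
    then have "mono_degree m = Suc k" using Suc.prems by simp
    then obtain i m' where m: "m = Poly_Mapping.single i 1 + m'" "mono_degree m' = k"
      by (rule mono_degree_SucE)
    have "Poly_Mapping.single (Poly_Mapping.single i 1) 1 * Poly_Mapping.single m' 1
        \<in> rpoly.span (affine_powers (Suc k))"
      using m(2) by (intro affine_mult_span Suc.IH) (simp_all add: total_degree_le_iff)
    then show ?thesis by (simp add: m(1) mult_single)
  qed
qed

lemma in_span_affine_powers:
  assumes "total_degree p \<le> k"
  shows "p \<in> rpoly.span (affine_powers k)"
proof -
  have "Poly_Mapping.single 0 (Poly_Mapping.lookup p m) * Poly_Mapping.single m 1 \<in> rpoly.span (affine_powers k)"
    if "m \<in> Poly_Mapping.keys p" for m
    using that assms by (intro rpoly.span_scale monomial_in_span) (simp add: total_degree_le_iff)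
  then show ?thesis
    by (subst poly_mapping_eq_sum_single) (auto simp: mult_single intro!: rpoly.span_sum)
qed

section \<open>Convex sums of squares\<close>

text \<open>Every monomial of \<open>l\<close> is a single variable, hence linear, or the constant
  1, for which \<open>u + v = 1\<close> is used.\<close>

lemma poly_eval_affine:
  fixes l :: "'n::finite rpoly"
  assumes l: "total_degree l \<le> 1" and uv: "u + v = 1"
  shows "poly_eval l (u *\<^sub>R x + v *\<^sub>R y) = u * poly_eval l x + v * poly_eval l y"
proof -
  have "(\<Prod>i\<in>UNIV. ((u *\<^sub>R x + v *\<^sub>R y) $ i) ^ Poly_Mapping.lookup m i)
      = u * (\<Prod>i\<in>UNIV. (x $ i) ^ Poly_Mapping.lookup m i) + v * (\<Prod>i\<in>UNIV. (y $ i) ^ Poly_Mapping.lookup m i)"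
    if m: "m \<in> Poly_Mapping.keys l" for m :: "'n mono"
  proof (cases "mono_degree m")
    case 0
    then show ?thesis using uv by simp
  next
    case (Suc k)
    then obtain i m' where i: "m = Poly_Mapping.single i 1 + m'" "mono_degree m' = k"
      by (rule mono_degree_SucE)
    have "k = 0" using Suc l m by (fastforce simp: total_degree_le_iff)
    with i have mi: "m = Poly_Mapping.single i 1" by simp
    have eval: "(\<Prod>j\<in>UNIV. (z $ j) ^ Poly_Mapping.lookup m j) = z $ i" for z :: "real ^ 'n"
      by (simp add: mi lookup_single when_def if_distrib[of "\<lambda>k. _ ^ k"] cong: if_cong)
    show ?thesis unfolding eval by simp
  qed
  then show ?thesis
    by (simp add: poly_eval_def sum_distrib_left sum.distrib[symmetric] algebra_simps cong: sum.cong)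
qed

lemma SOS_0 [simp]: "SOS 0"
  by (auto simp: SOS_def intro: exI[of _ "[]"])

lemma SOS_square: "SOS (p ^ 2)"
  by (auto simp: SOS_def intro: exI[of _ "[p]"])

lemma SOS_add:
  assumes "SOS p" "SOS q" shows "SOS (p + q)"
  using assms by (auto simp: SOS_def simp flip: sum_list_append map_append)

lemma CSOS_0 [simp]: "CSOS 0"
  by (simp add: CSOS_def poly_eval_0[abs_def] convex_on_def)

lemma CSOS_add: "CSOS p \<Longrightarrow> CSOS q \<Longrightarrow> CSOS (p + q)"
  by (auto simp: CSOS_def SOS_add poly_eval_add[abs_def] intro: convex_on_add)

text \<open>The factor \<open>sqrt c\<close> goes inside the square; convexity comes from composing
  an even power with an affine map.\<close>

lemma CSOS_affine_power:
  fixes l :: "'n::finite rpoly"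
  assumes l: "total_degree l \<le> 1" and c: "c \<ge> 0"
  shows "CSOS (Poly_Mapping.single 0 c * l ^ (2 * d))"
proof -
  have "Poly_Mapping.single 0 c * l ^ (2 * d) = (Poly_Mapping.single 0 (sqrt c) * l ^ d) ^ 2"
  proof -
    have "Poly_Mapping.single 0 c = (Poly_Mapping.single 0 (sqrt c) :: 'n rpoly) ^ 2"
      using c by (simp add: power2_eq_square mult_single)
    then show ?thesis by (simp add: power_mult_distrib mult.commute flip: power_mult)
  qed
  then have "SOS (Poly_Mapping.single 0 c * l ^ (2 * d))"
    by (simp add: SOS_square)
  moreover have "convex_on UNIV (\<lambda>x. c * poly_eval l x ^ (2 * d))"
  proof (intro convex_on_cmul c convex_onI convex_UNIV)
    fix t :: real and x y :: "real ^ 'n"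
    assume t: "0 < t" "t < 1"
    have "poly_eval l ((1 - t) *\<^sub>R x + t *\<^sub>R y) ^ (2 * d)
        = ((1 - t) *\<^sub>R poly_eval l x + t *\<^sub>R poly_eval l y) ^ (2 * d)"
      using l by (simp add: poly_eval_affine)
    also have "\<dots> \<le> (1 - t) * poly_eval l x ^ (2 * d) + t * poly_eval l y ^ (2 * d)"
      using t by (intro convex_onD[OF convex_power_even]) auto
    finally show "poly_eval l ((1 - t) *\<^sub>R x + t *\<^sub>R y) ^ (2 * d)
        \<le> (1 - t) * poly_eval l x ^ (2 * d) + t * poly_eval l y ^ (2 * d)" .
  qed
  ultimately show ?thesis
    by (simp add: CSOS_def poly_eval_mult[abs_def] poly_eval_power)
qed

section \<open>Existence of components of minimal degree\<close>

text \<open>Induction along a linear combination of \<open>2 * d\<close>-th powers: the sign of each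
  coefficient decides which component receives the term, and CSOS is closed under addition.\<close>

lemma DCSOS_components_exist:
  fixes p :: "'n::finite rpoly"
  assumes "total_degree p \<le> 2 * d"
  obtains s1 s2 where "DCSOS_components p s1 s2" "total_degree s1 \<le> 2 * d" "total_degree s2 \<le> 2 * d"
proof -
  have "p \<in> rpoly.span (affine_powers (2 * d))"
    using assms by (rule in_span_affine_powers)
  then have "\<exists>s1 s2. DCSOS_components p s1 s2 \<and> total_degree s1 \<le> 2 * d \<and> total_degree s2 \<le> 2 * d"
  proof (induction rule: rpoly.span_induct_alt)
    case base
    show ?case by (auto simp: DCSOS_components_def intro!: exI[of _ 0])
  next
    case (step c x y)
    then obtain l where l: "x = l ^ (2 * d)" "total_degree l \<le> 1"
      by (auto simp: affine_powers_def)
    from step obtain s1 s2 where s: "CSOS s1" "CSOS s2" "y = s1 - s2"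
      "total_degree s1 \<le> 2 * d" "total_degree s2 \<le> 2 * d"
      by (auto simp: DCSOS_components_def)
    define g where "g = (\<lambda>a. Poly_Mapping.single 0 a * x)"
    have g: "CSOS (g a)" if "a \<ge> 0" for a
      unfolding g_def l(1) using l(2) that by (rule CSOS_affine_power)
    have "total_degree (g a) \<le> 0 + 2 * d * 1" for a
      unfolding g_def l(1) using l(2)
      by (intro total_degree_mult_le total_degree_power_le) simp_all
    then have deg: "total_degree (g a) \<le> 2 * d" for a by simp
    show ?case
    proof (cases "c \<ge> 0")
      case True
      have "DCSOS_components (g c + y) (g c + s1) s2"
        using s g[OF True] by (simp add: DCSOS_components_def CSOS_add)
      with s deg show ?thesis by (metis g_def total_degree_add_le)
    next
      case False
      \<comment> \<open>A negative multiple is moved, with its sign reversed, to the subtracted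
        component.\<close>
      have "g c = - g (- c)" by (simp add: g_def single_uminus)
      with False have "DCSOS_components (g c + y) s1 (g (- c) + s2)"
        using s g[of "- c"] by (simp add: DCSOS_components_def CSOS_add)
      with s deg show ?thesis by (metis g_def total_degree_add_le)
    qed
  qed
  with that show thesis by blast
qed

lemma DCSOS_components_imp_DSOS_components:
  "DCSOS_components p s1 s2 \<Longrightarrow> DSOS_components p s1 s2"
  by (simp add: DCSOS_components_def DSOS_components_def CSOS_def)

text \<open>Components built from even powers of the least possible exponent meet the lower bound,
  which holds for DC-SOS components because they are also D-SOS components.\<close>

lemma DCSOS_components_optimal:
  fixes p :: "'n::finite rpoly"
  shows "\<exists>s1 s2. DCSOS_components p s1 s2 \<and>
    int (max (total_degree s1) (total_degree s2)) = 2 * \<lceil>real (total_degree p) / 2\<rceil>"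
proof -
  \<comment> \<open>Half the degree rounded up, so \<open>2 * ?d\<close> is the least even number
    that is at least the degree.\<close>
  let ?d = "(total_degree p + 1) div 2"
  have "total_degree p \<le> 2 * ?d" by presburger
  then obtain s1 s2 where s: "DCSOS_components p s1 s2"
    "total_degree s1 \<le> 2 * ?d" "total_degree s2 \<le> 2 * ?d"
    by (rule DCSOS_components_exist)
  then have "int (max (total_degree s1) (total_degree s2)) \<le> 2 * \<lceil>real (total_degree p) / 2\<rceil>"
    unfolding two_ceiling_half of_nat_le_iff by simp
  with s(1) show ?thesis
    using DSOS_components_degree_ge[OF DCSOS_components_imp_DSOS_components] by (metis antisym)
qed

theorem theorem2p11:
  shows
    "((UNIV :: 'n::finite rpoly set) = DSOS \<and> (DSOS :: 'n rpoly set) = DCSOS) \<and>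
     ((\<forall>(p :: 'n rpoly) s1 s2. DSOS_components p s1 s2 \<longrightarrow>
         int (max (total_degree s1) (total_degree s2)) \<ge> 2 * \<lceil>real (total_degree p) / 2\<rceil>) \<and>
      (\<forall>(p :: 'n rpoly) s1 s2. DCSOS_components p s1 s2 \<longrightarrow>
         int (max (total_degree s1) (total_degree s2)) \<ge> 2 * \<lceil>real (total_degree p) / 2\<rceil>)) \<and>
     ((\<forall>p :: 'n rpoly. \<exists>s1 s2. DSOS_components p s1 s2 \<and>
         int (max (total_degree s1) (total_degree s2)) = 2 * \<lceil>real (total_degree p) / 2\<rceil>) \<and>
      (\<forall>p :: 'n rpoly. \<exists>s1 s2. DCSOS_components p s1 s2 \<and>
         int (max (total_degree s1) (total_degree s2)) = 2 * \<lceil>real (total_degree p) / 2\<rceil>))"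
proof (intro conjI allI impI)
  \<comment> \<open>Both sets contain every polynomial, which gives the two equalities at
    once.\<close>
  have "p \<in> DCSOS \<and> p \<in> DSOS" for p :: "'n rpoly"
    using DCSOS_components_optimal[of p] DCSOS_components_imp_DSOS_components
    unfolding DCSOS_def DSOS_def by blast
  then show "(UNIV :: 'n rpoly set) = DSOS" "(DSOS :: 'n rpoly set) = DCSOS"
    by auto
next
  fix p :: "'n rpoly"
  show "\<exists>s1 s2. DCSOS_components p s1 s2 \<and>
      int (max (total_degree s1) (total_degree s2)) = 2 * \<lceil>real (total_degree p) / 2\<rceil>"
    by (rule DCSOS_components_optimal)
  then show "\<exists>s1 s2. DSOS_components p s1 s2 \<and>
      int (max (total_degree s1) (total_degree s2)) = 2 * \<lceil>real (total_degree p) / 2\<rceil>"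
    using DCSOS_components_imp_DSOS_components by blast
qed (rule DSOS_components_degree_ge, simp add: DCSOS_components_imp_DSOS_components)+

end
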